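(* Let $r\geq 2$ and let $m,a$ be integers with $1<m\leq a$. Define $\mathcal{F}=(f_1,\ldots,f_{3r})$ by $f_1=1$, $f_2=a$, $f_k=f_{k-1}+a$ if $k$ is odd and $3\leq k\leq 2r+1$, $f_k=f_{k-1}+(m-1)(2a-1)-a$ if $k$ is even and $3<k<2r+1$, and $f_k=f_{k-1}+(m-1)(2a-1)$ if $2r+1<k\leq 3r$. Then $\mathcal{F}$ has pattern $(+++-\cdots-+)$, i.e., its prefix coin systems of lengths $1,2,3$ are orderly, its prefix coin systems of lengths $4,\ldots,3r-1$ are not orderly, and $\mathcal{F}$ itself is orderly.
   Context: A coin system is a tuple $(c_1,\ldots,c_n)$ of integers with $c_1=1<c_2<\cdots<c_n$; each coin value may be used any number of times. For a positive integer $v$, $opt(v)$ is the minimum number of coins summing to $v$, and $grd(v)$ is the number of coins used by the greedy algorithm (repeatedly take as many coins as possible of the largest coin value not exceeding the remaining amount). A coin system is orderly if $grd(v)=opt(v)$ for all $v>0$. The prefix coin system of length $i$ is $(c_1,\ldots,c_i)$; the pattern of a coin system is the string whose $i$-th symbol is $+$ if the prefix of length $i$ is orderly and $-$ otherwise. *)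

theory Defs
  imports Main "HOL-Library.Multiset"
begin

definition coin_system :: "int list \<Rightarrow> bool" where
  "coin_system C \<longleftrightarrow> C \<noteq> [] \<and> hd C = 1 \<and> sorted_wrt (<) C"

definition opt :: "int list \<Rightarrow> int \<Rightarrow> nat" where
  "opt C v = (LEAST n. \<exists>M. set_mset M \<subseteq> set C \<and> sum_mset M = v \<and> size M = n)"

(* The test 0 < c only serves to make the recursion total on arbitrary lists; it always holds
   in a coin system. There, since 1 is a coin, the recursion from v > 0 stops exactly when
   the remaining amount is 0. *)
function grd :: "int list \<Rightarrow> int \<Rightarrow> nat" where
  "grd C v =
     (if \<exists>c\<in>set C. 0 < c \<and> c \<le> v
      then let c = Max {c \<in> set C. 0 < c \<and> c \<le> v} in nat (v div c) + grd C (v mod c)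
      else 0)"
  by pat_completeness auto
termination
proof (relation "measure (\<lambda>(C, v). nat v)", goal_cases)
  case 1
  then show ?case by simp
next
  case (2 C v c)
  have "c \<in> {c \<in> set C. 0 < c \<and> c \<le> v}"
    unfolding 2(2) using 2(1) by (intro Max_in) auto
  then have c: "0 < c" "c \<le> v" by auto
  then have "v mod c < v" using pos_mod_bound[of c v] by linarith
  with c show ?case by simp
qed

declare grd.simps [simp del]

definition orderly :: "int list \<Rightarrow> bool" where
  "orderly C \<longleftrightarrow> (\<forall>v>0. grd C v = opt C v)"

definition pattern :: "int list \<Rightarrow> string" where
  "pattern C = map (\<lambda>i. if orderly (take i C) then CHR ''+'' else CHR ''-'') [1..<length C + 1]"

end

theory Submission
  imports Defs
begin

text \<open>With \<open>s = (m - 1) (2 a - 1)\<close> and \<open>w = r - 1\<close>, the coins are \<open>1\<close>, the units \<open>a + j s\<close> for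
  \<open>j \<le> w\<close>, and all sums of two units, \<open>2 a + j s\<close> for \<open>j \<le> 2 w\<close>. Hence the optimum for \<open>v\<close> is
  the minimum of \<open>x + \<lceil>u / 2\<rceil>\<close> over all \<open>v = x + u a + J s\<close> with \<open>J \<le> u w\<close>. Since
  \<open>s + (m - 1) = (2 m - 2) a\<close>, summands \<open>s\<close> can be split off the part \<open>x + u a\<close> without raising
  this cost, which turns any representation into one that contains the greedy coin; for \<open>w = 0\<close>
  the argument also covers \<open>(1, a, 2 a)\<close>. A proper prefix with at least four coins misses a sum
  of two of its units if its last coin is \<open>2 a + j s\<close>, and fails at \<open>2 a + (j - 1) s + (m - 1) 2 a\<close>
  if its last coin is \<open>a + j s\<close>.\<close>

section \<open>The greedy algorithm\<close>

lemma grd_nonpos: "v \<le> 0 \<Longrightarrow> grd C v = 0"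
  by (subst grd.simps) auto

text \<open>\<open>grd\<close> takes all copies of the largest coin at once, but exchange arguments
  need one at a time. If \<open>c\<close> fits into \<open>v - c\<close>, it is again the maximum
  there and the quotient drops by one; otherwise the quotient is 1 and \<open>v - c\<close> is the
  remainder.\<close>

lemma grd_step:
  assumes "c \<in> set C" "0 < c" "c \<le> v" and max: "\<And>d. d \<in> set C \<Longrightarrow> d \<le> v \<Longrightarrow> d \<le> c"
  shows "grd C v = Suc (grd C (v - c))"
proof -
  have Max_eq: "Max {d \<in> set C. 0 < d \<and> d \<le> v'} = c" if "c \<le> v'" "v' \<le> v" for v'
    using assms that by (intro Max_eqI) auto
  have unfold: "grd C v' = nat (v' div c) + grd C (v' mod c)" if "c \<le> v'" "v' \<le> v" for v'
    using assms that by (subst grd.simps) (auto simp: Let_def Max_eq)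
  have div_mod: "v div c = (v - c) div c + 1" "(v - c) mod c = v mod c"
    using assms by (simp_all add: div_add_self2[of c "v - c", symmetric])
  show ?thesis
  proof (cases "c \<le> v - c")
    case True
    have "0 \<le> (v - c) div c"
      using assms by (simp add: pos_imp_zdiv_nonneg_iff)
    then show ?thesis
      using True assms unfold[of v] unfold[of "v - c"] div_mod by (simp add: nat_add_distrib)
  next
    case False
    then have "(v - c) div c = 0" "(v - c) mod c = v - c"
      using assms(3) by (intro div_pos_pos_trivial mod_pos_pos_trivial; linarith)+
    with div_mod have "v div c = 1" "v mod c = v - c"
      by linarith+
    then show ?thesis
      using unfold[OF assms(3) order_refl] by simp
  qed
qed

lemma obtain_greedy_coin:
  assumes "1 \<in> set C" "0 < (v::int)"
  obtains c where "c \<in> set C" "0 < c" "c \<le> v" "\<And>d. d \<in> set C \<Longrightarrow> d \<le> v \<Longrightarrow> d \<le> c"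
proof -
  let ?S = "{c \<in> set C. c \<le> v}"
  have 1: "finite ?S" "1 \<in> ?S"
    using assms by auto
  have "Max ?S \<in> ?S"
    using 1 by (intro Max_in) auto
  moreover have "1 \<le> Max ?S"
    using 1 by (rule Max_ge)
  ultimately show ?thesis
    using that[of "Max ?S"] 1(1) by auto
qed

lemma greedy_representation:
  assumes "1 \<in> set C" "0 \<le> v"
  shows "\<exists>N. set_mset N \<subseteq> set C \<and> sum_mset N = v \<and> size N = grd C v"
  using \<open>0 \<le> v\<close>
proof (induction "nat v" arbitrary: v rule: less_induct)
  case less
  show ?case
  proof (cases "v = 0")
    case True
    then show ?thesis
      by (intro exI[of _ "{#}"]) (simp add: grd_nonpos)
  next
    case False
    then have "0 < v"
      using less.prems by simp
    then obtain c where c: "c \<in> set C" "0 < c" "c \<le> v" "\<And>d. d \<in> set C \<Longrightarrow> d \<le> v \<Longrightarrow> d \<le> c"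
      using obtain_greedy_coin[OF assms(1)] by metis
    moreover have "nat (v - c) < nat v" "0 \<le> v - c"
      using c by auto
    ultimately obtain N where "set_mset N \<subseteq> set C" "sum_mset N = v - c" "size N = grd C (v - c)"
      using less.hyps by blast
    then show ?thesis
      using c grd_step[OF c] by (intro exI[of _ "add_mset c N"]) auto
  qed
qed

lemma opt_le: "set_mset N \<subseteq> set C \<Longrightarrow> opt C (sum_mset N) \<le> size N"
  unfolding opt_def by (rule Least_le) blast

lemma grd_ge_2:
  assumes "1 \<in> set C" "0 < v" "v \<notin> set C"
  shows "2 \<le> grd C v"
proof (rule ccontr)
  assume "\<not> 2 \<le> grd C v"
  moreover obtain N where N: "set_mset N \<subseteq> set C" "sum_mset N = v" "size N = grd C v"
    using greedy_representation[of C v] assms by auto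
  ultimately have "size N = 0 \<or> size N = 1"
    by linarith
  then show False
    using N assms size_1_singleton_mset[of N] by auto
qed

lemma grd_ones:
  assumes "1 \<in> set C" "\<And>d. d \<in> set C \<Longrightarrow> d \<le> int n \<Longrightarrow> d \<le> 1"
  shows "grd C (int n) = n"
  using assms(2)
proof (induction n)
  case 0
  then show ?case
    by (simp add: grd_nonpos)
next
  case (Suc n)
  have "grd C (int (Suc n)) = Suc (grd C (int (Suc n) - 1))"
    using assms(1) Suc.prems by (intro grd_step) auto
  then show ?case
    using Suc by simp
qed

text \<open>Induction on \<open>size N\<close>: removing the greedy coin costs \<open>grd\<close>
  one step and leaves an amount with a strictly smaller representation, so \<open>grd\<close> is at
  most the size of every representation. \<open>N'\<close> need not consist of coins of
  \<open>N\<close>.\<close>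

lemma orderly_if_exchange:
  assumes "1 \<in> set C" and pos: "\<And>c. c \<in> set C \<Longrightarrow> 0 < c"
    and exchange: "\<And>N c. set_mset N \<subseteq> set C \<Longrightarrow> c \<in> set C \<Longrightarrow> c \<le> sum_mset N \<Longrightarrow>
      (\<And>d. d \<in> set C \<Longrightarrow> d \<le> sum_mset N \<Longrightarrow> d \<le> c) \<Longrightarrow>
      \<exists>N'. set_mset N' \<subseteq> set C \<and> sum_mset N' = sum_mset N - c \<and> size N' < size N"
  shows "orderly C"
proof -
  have le: "grd C (sum_mset N) \<le> size N" if "set_mset N \<subseteq> set C" for N
    using that
  proof (induction "size N" arbitrary: N rule: less_induct)
    case less
    show ?case
    proof (cases "0 < sum_mset N")
      case True
      then obtain c where c: "c \<in> set C" "0 < c" "c \<le> sum_mset N"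
          "\<And>d. d \<in> set C \<Longrightarrow> d \<le> sum_mset N \<Longrightarrow> d \<le> c"
        using obtain_greedy_coin[OF assms(1)] by metis
      then obtain N' where "set_mset N' \<subseteq> set C" "sum_mset N' = sum_mset N - c" "size N' < size N"
        using exchange[OF less.prems] by blast
      then show ?thesis
        using less.hyps[of N'] grd_step[OF c] by simp
    qed (simp add: grd_nonpos)
  qed
  have "opt C v = grd C v" if "0 < v" for v
    unfolding opt_def
  proof (rule Least_equality)
    show "\<exists>N. set_mset N \<subseteq> set C \<and> sum_mset N = v \<and> size N = grd C v"
      using greedy_representation[of C v] assms(1) that by simp
  qed (use le in blast)
  then show ?thesis
    by (simp add: orderly_def)
qed

section \<open>Systems of one and two coins\<close>

lemma orderly_single: "orderly [1]"
proof (rule orderly_if_exchange)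
  fix N :: "int multiset" and c :: int
  assume N: "set_mset N \<subseteq> set [1]" and c: "c \<in> set [1]" "c \<le> sum_mset N"
  then have "N \<noteq> {#}" by auto
  then obtain N' where "N = add_mset 1 N'"
    using N by (metis empty_set insertE insert_subset list.simps(15) multiset_cases set_mset_add_mset_insert empty_iff)
  then show "\<exists>N'. set_mset N' \<subseteq> set [1] \<and> sum_mset N' = sum_mset N - c \<and> size N' < size N"
    using N c by (intro exI[of _ N']) auto
qed auto

lemma orderly_pair:
  assumes "1 < a"
  shows "orderly [1, a]"
proof (rule orderly_if_exchange)
  fix N :: "int multiset" and c :: int
  assume N: "set_mset N \<subseteq> set [1, a]" and c: "c \<in> set [1, a]" "c \<le> sum_mset N"
    and max: "\<And>d. d \<in> set [1, a] \<Longrightarrow> d \<le> sum_mset N \<Longrightarrow> d \<le> c"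
  show "\<exists>N'. set_mset N' \<subseteq> set [1, a] \<and> sum_mset N' = sum_mset N - c \<and> size N' < size N"
  proof (cases "c \<in># N")
    case True
    then obtain N' where "N = add_mset c N'"
      by (metis insert_DiffM)
    then show ?thesis
      using N by (intro exI[of _ N']) auto
  next
    case False
    \<comment> \<open>If the greedy coin is missing from \<open>N\<close>, so is \<open>a\<close>:
      either \<open>c = a\<close>, or any \<open>a\<close> in \<open>N\<close> would fit below the
      total and exceed \<open>c\<close>.\<close>
    then have ones: "set_mset N \<subseteq> {1}"
    proof (cases "c = a")
      case True
      then show ?thesis using False N by auto
    next
      case neq: False
      then have "N = {#} \<or> a \<in># N"
        using False N c by (metis (no_types, lifting) empty_iff empty_set insertE list.simps(15) multiset_nonemptyE subsetD)
      moreover have "a \<notin># N"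
      proof
        assume "a \<in># N"
        then obtain N' where N': "N = add_mset a N'"
          by (metis insert_DiffM)
        moreover have "0 \<le> sum_mset M" if "set_mset M \<subseteq> set [1, a]" for M
          using that assms by (induction M) auto
        then have "0 \<le> sum_mset N'"
          using N N' by simp
        ultimately show False
          using max[of a] neq c assms by auto
      qed
      ultimately show ?thesis by auto
    qed
    then have eq: "sum_mset N = int (size N)"
      by (induction N) auto
    then show ?thesis
      using c assms by (intro exI[of _ "replicate_mset (nat (sum_mset N - c)) 1"]) auto
  qed
qed (use assms in auto)

section \<open>Coins as sums of units\<close>

locale units =
  fixes a m s :: int and w :: nat
  assumes m_gt_1: "1 < m" and m_le_a: "m \<le> a" and s_def: "s = (m - 1) * (2 * a - 1)"
begin

definition coins :: "int set" where
  "coins = insert 1 ({a + int j * s |j. j \<le> w} \<union> {2 * a + int j * s |j. j \<le> 2 * w})"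

text \<open>A \<^emph>\<open>unit\<close> is one of the coins \<open>a + j s\<close>; the coins \<open>2 a + j s\<close> are exactly the sums of
  two units. Here \<open>u\<close> units with total index \<open>J\<close> are packed in pairs.\<close>

definition value_of :: "nat \<Rightarrow> nat \<Rightarrow> nat \<Rightarrow> int" where
  "value_of x u J = int x + int u * a + int J * s"

definition cost :: "nat \<Rightarrow> nat \<Rightarrow> nat" where
  "cost x u = x + (u + 1) div 2"

lemma a_gt_1: "1 < a"
  using m_gt_1 m_le_a by simp

lemma s_ge: "2 * a - 1 \<le> s"
  using mult_right_mono[of 1 "m - 1" "2 * a - 1"] m_gt_1 a_gt_1 by (simp add: s_def)

lemma s_gt_a: "a < s"
  using s_ge a_gt_1 by simp

lemma coins_pos: "c \<in> coins \<Longrightarrow> 0 < c"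
  using a_gt_1 s_gt_a by (auto simp: coins_def add_pos_nonneg)

text \<open>Each coin raises the cost by at most one: \<open>1\<close> adds to \<open>x\<close>, the
  other coins add one or two units. Only an inequality results, since single units of
  \<open>N\<close> get packed in pairs.\<close>

lemma units_of_multiset:
  assumes "set_mset N \<subseteq> coins"
  shows "\<exists>x u J. sum_mset N = value_of x u J \<and> J \<le> u * w \<and> cost x u \<le> size N"
  using assms
proof (induction N)
  case empty
  show ?case
    by (intro exI[of _ 0]) (simp add: value_of_def cost_def)
next
  case (add c N)
  then obtain x u J where *: "sum_mset N = value_of x u J" "J \<le> u * w" "cost x u \<le> size N"
    by auto
  from add.prems consider "c = 1" | j where "j \<le> w" "c = a + int j * s"
    | j where "j \<le> 2 * w" "c = 2 * a + int j * s"
    by (auto simp: coins_def)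
  then show ?case
  proof cases
    case 1
    with * show ?thesis
      by - (rule exI[of _ "Suc x"], rule exI[of _ u], rule exI[of _ J],
          auto simp: value_of_def cost_def)
  next
    case 2
    with * show ?thesis
      by - (rule exI[of _ x], rule exI[of _ "Suc u"], rule exI[of _ "J + j"],
          auto simp: value_of_def cost_def algebra_simps)
  next
    case 3
    with * show ?thesis
      by - (rule exI[of _ x], rule exI[of _ "u + 2"], rule exI[of _ "J + j"],
          auto simp: value_of_def cost_def algebra_simps)
  qed
qed

lemma multiset_of_units:
  assumes "J \<le> u * w"
  shows "\<exists>N. set_mset N \<subseteq> coins \<and> sum_mset N = value_of x u J \<and> size N = cost x u"
proof -
  have "\<exists>N. set_mset N \<subseteq> coins \<and> sum_mset N = value_of 0 u J \<and> size N = cost 0 u"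
    using assms
  proof (induction u arbitrary: J rule: less_induct)
    case (less u)
    consider "u = 0" | "u = 1" | u' where "u = u' + 2"
      by (metis One_nat_def add_2_eq_Suc' not0_implies_Suc)
    then show ?case
    proof cases
      case 1
      with less show ?thesis
        by (intro exI[of _ "{#}"]) (auto simp: value_of_def cost_def)
    next
      case 2
      with less show ?thesis
        by (intro exI[of _ "{#a + int J * s#}"]) (auto simp: value_of_def cost_def coins_def)
    next
      case 3
      \<comment> \<open>Giving the pair the largest possible index keeps the remaining index within
        \<open>u' * w\<close>.\<close>
      define j where "j = min J (2 * w)"
      have j: "j \<le> J" "j \<le> 2 * w" "J - j \<le> u' * w"
        using less.prems 3 by (auto simp: j_def algebra_simps)
      then obtain N where "set_mset N \<subseteq> coins" "sum_mset N = value_of 0 u' (J - j)"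
          "size N = cost 0 u'"
        using less.IH[of u' "J - j"] 3 by auto
      with j 3 show ?thesis
        by (intro exI[of _ "add_mset (2 * a + int j * s) N"])
          (auto simp: value_of_def cost_def coins_def algebra_simps of_nat_diff)
    qed
  qed
  then obtain N where "set_mset N \<subseteq> coins" "sum_mset N = value_of 0 u J" "size N = cost 0 u"
    by blast
  then show ?thesis
    by (intro exI[of _ "N + replicate_mset x 1"])
      (auto simp: value_of_def cost_def coins_def split: if_splits)
qed

section \<open>Taking \<open>s\<close> and whole coins out of a representation\<close>

text \<open>At \<open>u = 2 * m - 3\<close> both sides equal \<open>m - 1\<close>; each unit fewer
  lowers the left by \<open>a \<ge> 2\<close> and the right by at most one. Hence ones alone can pay
  what few units leave.\<close>

lemma few_units:
  assumes "int u \<le> 2 * m - 3"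
  shows "int u * a + a - s \<le> int ((u + 1) div 2)"
proof -
  define t where "t = 2 * m - 3 - int u"
  have eq: "int u * a + a - s = m - 1 - a * t"
    by (simp add: t_def s_def algebra_simps)
  have half: "int u \<le> 2 * int ((u + 1) div 2)"
    by linarith
  show ?thesis
  proof (cases "t = 0")
    case True
    then show ?thesis
      using eq half by (simp add: t_def)
  next
    case False
    then have "1 \<le> t"
      using assms by (simp add: t_def)
    then have "2 * t \<le> a * t"
      using a_gt_1 by (intro mult_right_mono) auto
    moreover have "int u = 2 * m - 3 - t"
      by (simp add: t_def)
    ultimately have "m - 1 - a * t \<le> int ((u + 1) div 2)"
      using half \<open>1 \<le> t\<close> by linarith
    then show ?thesis
      using eq by simp
  qed
qed

text \<open>The identity \<open>s + (m - 1) = (2 m - 2) a\<close> trades \<open>m - 1\<close> pairs of units for \<open>m - 1\<close> ones.\<close>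

lemma remove_s:
  assumes "s \<le> value_of x u 0"
  shows "\<exists>x' u'. value_of x' u' 0 = value_of x u 0 - s \<and> cost x' u' \<le> cost x u"
proof (cases "2 * m - 2 \<le> int u")
  case True
  define k where "k = nat (m - 1)"
  have k: "m = int k + 1" "2 * k \<le> u"
    using True m_gt_1 by (auto simp: k_def)
  have s: "s = int k * (2 * a - 1)"
    using s_def k(1) by simp
  have "value_of (x + k) (u - 2 * k) 0 = value_of x u 0 - s"
    unfolding value_of_def unfolding s using k(2) by (simp add: of_nat_diff algebra_simps)
  moreover have "cost (x + k) (u - 2 * k) \<le> cost x u"
    using k by (simp add: cost_def)
  ultimately show ?thesis by blast
next
  case False
  \<comment> \<open>There are too few units for the trade, so little is left after taking
    \<open>s\<close> that ones alone stay within the cost.\<close>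
  then have "int u * a + a - s \<le> int ((u + 1) div 2)"
    by (intro few_units) auto
  then show ?thesis
    using assms a_gt_1
    by - (rule exI[of _ "nat (value_of x u 0 - s)"], rule exI[of _ 0],
        simp add: value_of_def cost_def)
qed

lemma remove_multiple_s:
  assumes "int d * s \<le> value_of x u 0"
  shows "\<exists>x' u'. value_of x' u' 0 = value_of x u 0 - int d * s \<and> cost x' u' \<le> cost x u"
  using assms
proof (induction d arbitrary: x u)
  case 0
  show ?case by auto
next
  case (Suc d)
  have "0 \<le> int d * s"
    using s_gt_a a_gt_1 by simp
  then have "s \<le> value_of x u 0"
    using Suc.prems by (simp add: algebra_simps)
  then obtain x' u' where 1: "value_of x' u' 0 = value_of x u 0 - s" "cost x' u' \<le> cost x u"
    using remove_s by blast
  then have "int d * s \<le> value_of x' u' 0"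
    using Suc.prems by (simp add: algebra_simps)
  from Suc.IH[OF this] obtain x'' u'' where "value_of x'' u'' 0 = value_of x' u' 0 - int d * s"
      "cost x'' u'' \<le> cost x' u'"
    by blast
  with 1 show ?case
    by - (rule exI[of _ x''], rule exI[of _ u''], simp add: algebra_simps)
qed

text \<open>Every \<open>a\<close> ones are traded for one unit of index 0. The bound on the ones
  lets the number of units locate the value.\<close>

lemma few_ones:
  assumes "J \<le> u * w"
  shows "\<exists>x' u'. value_of x' u' J = value_of x u J \<and> J \<le> u' * w \<and> cost x' u' \<le> cost x u \<and> int x' < a"
proof -
  define b where "b = nat a"
  have b: "a = int b" "1 < b"
    using a_gt_1 by (auto simp: b_def)
  have eq: "x = x mod b + x div b * b"
    by simp
  have "value_of (x mod b) (u + x div b) J = value_of x u J"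
    using arg_cong[OF eq, of int] unfolding value_of_def unfolding b of_nat_add of_nat_mult
    by (simp add: algebra_simps)
  moreover have "J \<le> (u + x div b) * w"
    using assms by (simp add: algebra_simps)
  moreover have "cost (x mod b) (u + x div b) \<le> cost x u"
  proof -
    have "x div b \<le> x div b * b"
      using b by simp
    then show ?thesis
      using eq unfolding cost_def by linarith
  qed
  moreover have "int (x mod b) < a"
    using b by simp
  ultimately show ?thesis by blast
qed

text \<open>Two units give up the whole index \<open>J\<close>; the missing
  \<open>(j - J) * s\<close> is split off the index-free rest at no cost, so one coin is
  saved.\<close>

lemma remove_pair:
  assumes "J \<le> u * w" "2 \<le> u" "J \<le> j" "2 * a + int j * s \<le> value_of x u J"
  shows "\<exists>x' u'. value_of x' u' 0 = value_of x u J - (2 * a + int j * s) \<and> cost x' u' < cost x u"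
proof -
  have eq: "value_of x u J - (2 * a + int j * s) = value_of x (u - 2) 0 - int (j - J) * s"
    using assms by (simp add: value_of_def of_nat_diff algebra_simps)
  then obtain x' u' where "value_of x' u' 0 = value_of x u J - (2 * a + int j * s)"
      "cost x' u' \<le> cost x (u - 2)"
    using remove_multiple_s[of "j - J" x "u - 2"] assms by auto
  moreover have "cost x (u - 2) < cost x u"
    using assms by (simp add: cost_def)
  ultimately show ?thesis
    by (meson order_le_less_trans)
qed

lemma index_le:
  assumes "int i * s \<le> int j * s + d" "d < s"
  shows "i \<le> j"
proof (rule ccontr)
  assume "\<not> i \<le> j"
  then have "int (j + 1) * s \<le> int i * s"
    using s_gt_a a_gt_1 by (intro mult_right_mono) auto
  then show False
    using assms by (simp add: algebra_simps)
qed

text \<open>This is the exchange hypothesis of \<open>orderly_if_exchange\<close> in terms of units,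
  by cases on the kind of the greedy coin.\<close>

lemma exchange_units:
  assumes "J \<le> u * w" "c \<in> coins" "c \<le> value_of x u J"
    and max: "\<And>d. d \<in> coins \<Longrightarrow> d \<le> value_of x u J \<Longrightarrow> d \<le> c"
  shows "\<exists>x' u' J'. value_of x' u' J' = value_of x u J - c \<and> J' \<le> u' * w \<and> cost x' u' < cost x u"
proof -
  obtain x1 u1 where 1: "value_of x1 u1 J = value_of x u J" "J \<le> u1 * w" "cost x1 u1 \<le> cost x u"
      "int x1 < a"
    using few_ones[OF assms(1)] by blast
  define v where "v = value_of x u J"
  have v: "v = int x1 + int u1 * a + int J * s"
    using 1 by (simp add: v_def value_of_def)
  have s: "0 < s"
    using s_gt_a a_gt_1 by simp
  have cv: "c \<le> v" and max: "\<And>d. d \<in> coins \<Longrightarrow> d \<le> v \<Longrightarrow> d \<le> c"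
    using assms by (auto simp: v_def)
  \<comment> \<open>With \<open>x1 < a\<close>, the unit count locates \<open>v\<close>: below
    \<open>a\<close> for none, from \<open>a + J * s\<close> to below \<open>2 * a + J * s\<close>
    for one, at least \<open>2 * a + J * s\<close> for more.\<close>
  have u0: "v < a" if "u1 = 0"
    using v that 1 by simp
  have ge_a: "a \<le> v" if "u1 \<noteq> 0"
    using v that mult_right_mono[of 1 "int u1" a] a_gt_1 s
    by (smt (verit) mult_nonneg_nonneg of_nat_0_le_iff mult_1 of_nat_1 of_nat_le_iff Suc_leI One_nat_def gr0I)
  have u1: "J \<le> w" "v < 2 * a + int J * s" "a + int J * s \<le> v" if "u1 = 1"
    using v that 1 by auto
  have u2: "2 * a + int J * s \<le> v" if "2 \<le> u1"
  proof -
    have "2 * a \<le> int u1 * a"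
      using that a_gt_1 by (intro mult_right_mono) auto
    then show ?thesis
      unfolding v by linarith
  qed
  have "\<exists>x' u' J'. value_of x' u' J' = v - c \<and> J' \<le> u' * w \<and> cost x' u' < cost x1 u1"
  proof -
    from assms(2) consider (one) "c = 1" | (unit) j where "j \<le> w" "c = a + int j * s"
      | (pair) j where "j \<le> 2 * w" "c = 2 * a + int j * s"
      by (auto simp: coins_def)
    then show ?thesis
    proof cases
      case one
      have "a \<in> coins"
        by (auto simp: coins_def intro!: exI[of _ 0])
      then have "v < a"
        using max[of a] one a_gt_1 by force
      then have "u1 = 0"
        using ge_a by force
      then show ?thesis
        using v 1 cv one
        by - (rule exI[of _ "x1 - 1"], rule exI[of _ 0], rule exI[of _ 0],
            auto simp: value_of_def cost_def of_nat_diff)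
    next
      case unit
      have "2 * a + int j * s \<in> coins"
        using unit by (auto simp: coins_def)
      then have v_less: "v < 2 * a + int j * s"
        using max[of "2 * a + int j * s"] unit a_gt_1 by force
      have "a \<le> v"
        using cv unit s by (smt (verit) mult_nonneg_nonneg of_nat_0_le_iff)
      then consider "u1 = 1" | "2 \<le> u1"
        using u0 by fastforce
      then show ?thesis
      proof cases
        case 1
        \<comment> \<open>Both \<open>v - a - J * s\<close> and \<open>v - a - j * s\<close> lie
          between 0 and \<open>a < s\<close>, so the only unit is the greedy coin itself.\<close>
        have "J = j"
          using u1[OF 1] cv v_less unit s_gt_a index_le[of J j a] index_le[of j J a] by simp
        then have "v = int x1 + a + int j * s"
          using v 1 by simp
        then show ?thesis
          using 1 unit
          by - (rule exI[of _ x1], rule exI[of _ 0], rule exI[of _ 0],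
              auto simp: value_of_def cost_def)
      next
        case 2
        have "J \<le> j"
          using u2[OF 2] v_less s by (intro index_le[where d = 0]) linarith+
        moreover have "J \<noteq> j"
          using u2[OF 2] v_less by auto
        ultimately obtain i where i: "j = Suc i" "J \<le> i"
          by (cases j) auto
        \<comment> \<open>The pair with index \<open>i = j - 1\<close> is below \<open>c\<close>
          because \<open>a < s\<close>. Removing it instead of \<open>c\<close> leaves
          \<open>v - c + (s - a)\<close>.\<close>
        then obtain x' u' where x'u': "value_of x' u' 0 = v - (2 * a + int i * s)"
            "cost x' u' < cost x1 u1"
          using remove_pair[of J u1 i x1] 1(1,2) 2 cv unit s_gt_a by (auto simp: v_def algebra_simps)
        \<comment> \<open>The rest is below \<open>s\<close>, whereas \<open>2 * m - 2\<close> units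
          are worth \<open>s + (m - 1)\<close>. So \<open>few_units\<close> applies, and
          \<open>v - c\<close> can be paid in ones.\<close>
        have "int u' \<le> 2 * m - 3"
        proof (rule ccontr)
          assume "\<not> int u' \<le> 2 * m - 3"
          then have "(2 * m - 2) * a \<le> int u' * a"
            using a_gt_1 by (intro mult_right_mono) auto
          moreover have "int u' * a < s"
            using x'u'(1) v_less i by (simp add: value_of_def algebra_simps)
          ultimately show False
            using m_gt_1 by (simp add: s_def algebra_simps)
        qed
        then have "v - c \<le> int (cost x' u')"
          using few_units[of u'] x'u' i unit by (simp add: value_of_def cost_def algebra_simps)
        then show ?thesis
          using cv x'u'
          by - (rule exI[of _ "nat (v - c)"], rule exI[of _ 0], rule exI[of _ 0],
              auto simp: value_of_def cost_def)
      qed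
    next
      case pair
      have top: "i \<le> j" if "i \<le> 2 * w" "2 * a + int i * s \<le> v" for i
        using max[of "2 * a + int i * s"] that pair s
        by (intro index_le[where d = 0]) (auto simp: coins_def)
      have "a \<le> v"
        using cv pair s a_gt_1 by (smt (verit) mult_nonneg_nonneg of_nat_0_le_iff)
      then consider "u1 = 1" | "2 \<le> u1"
        using u0 by fastforce
      then show ?thesis
      proof cases
        case 1
        \<comment> \<open>The coin \<open>a + J * s\<close> fits, so it is at most \<open>c\<close>
          and \<open>J \<le> j\<close>; but a single unit keeps \<open>v\<close> below
          \<open>2 * a + J * s\<close>, contradicting \<open>c \<le> v\<close>.\<close>
        have "J \<le> j"
          using max[of "a + int J * s"] u1[OF 1] pair s_gt_a
          by (intro index_le[where d = a]) (auto simp: coins_def)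
        then have "int J * s \<le> int j * s"
          using s by simp
        then show ?thesis
          using u1[OF 1] cv pair by simp
      next
        case 2
        show ?thesis
        proof (cases "J \<le> j")
          case True
          then show ?thesis
            using remove_pair[of J u1 j x1] 1(1,2) 2 cv pair by (fastforce simp: v_def)
        next
          case False
          \<comment> \<open>Capped at \<open>2 * w\<close>, the index \<open>J\<close> belongs to a
            pair that fits. Hence a greedy index below \<open>J\<close> is the top one, and two
            units can give up exactly \<open>2 * w\<close>.\<close>
          have "int (min J (2 * w)) * s \<le> int J * s"
            using s by (intro mult_right_mono) auto
          then have "min J (2 * w) \<le> j"
            using top[of "min J (2 * w)"] u2[OF 2] by simp
          then have j: "j = 2 * w" "j \<le> J"
            using pair False by auto
          obtain u' where "u1 = u' + 2"
            using 2 le_Suc_ex by (metis add.commute)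
          then show ?thesis
            using j v pair 1(2)
            by - (rule exI[of _ x1], rule exI[of _ u'], rule exI[of _ "J - j"],
                auto simp: value_of_def cost_def of_nat_diff algebra_simps)
        qed
      qed
    qed
  qed
  with 1 show ?thesis
    unfolding v_def by (meson order_less_le_trans)
qed

theorem orderly_units:
  assumes "set C = coins"
  shows "orderly C"
proof (rule orderly_if_exchange)
  fix N c
  assume N: "set_mset N \<subseteq> set C" and c: "c \<in> set C" "c \<le> sum_mset N"
    "\<And>d. d \<in> set C \<Longrightarrow> d \<le> sum_mset N \<Longrightarrow> d \<le> c"
  obtain x u J where 1: "sum_mset N = value_of x u J" "J \<le> u * w" "cost x u \<le> size N"
    using units_of_multiset N assms by blast
  then obtain x' u' J' where 2: "value_of x' u' J' = sum_mset N - c" "J' \<le> u' * w"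
      "cost x' u' < cost x u"
    using exchange_units[of J u c x] c assms by auto
  show "\<exists>N'. set_mset N' \<subseteq> set C \<and> sum_mset N' = sum_mset N - c \<and> size N' < size N"
    using multiset_of_units[OF 2(2), of x'] 1 2 assms by auto
qed (use assms coins_pos in \<open>auto simp: coins_def\<close>)

end

section \<open>The coin system of the theorem\<close>

text \<open>Closed form of the recurrence for \<open>r = w + 1\<close>: units and pairs alternate up
  to position \<open>2 * w + 3\<close>, then only pairs follow. The two pair formulas agree at
  \<open>j = w\<close>.\<close>

locale coin_chain = units +
  fixes f :: "nat \<Rightarrow> int"
  assumes w_pos: "1 \<le> w"
    and f_1: "f 1 = 1"
    and f_single: "j \<le> w \<Longrightarrow> f (2 * j + 2) = a + int j * s"
    and f_pair_low: "j \<le> w \<Longrightarrow> f (2 * j + 3) = 2 * a + int j * s"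
    and f_pair_high: "w \<le> j \<Longrightarrow> j \<le> 2 * w \<Longrightarrow> f (w + j + 3) = 2 * a + int j * s"
begin

abbreviation prefix_system :: "nat \<Rightarrow> int list" where
  "prefix_system n \<equiv> map f [1..<n + 1]"

lemma index_cases:
  assumes "1 \<le> k" "k \<le> 3 * w + 3"
  obtains (one) "k = 1" | (single) j where "j \<le> w" "k = 2 * j + 2"
    | (low) j where "j < w" "k = 2 * j + 3" | (high) j where "w \<le> j" "j \<le> 2 * w" "k = w + j + 3"
proof -
  consider "k = 1" | "2 \<le> k" "k < 2 * w + 3" "even k" | "2 \<le> k" "k < 2 * w + 3" "odd k"
    | "2 * w + 3 \<le> k"
    using assms by linarith
  then show ?thesis
  proof cases
    case 1
    then show ?thesis by (rule one)
  next
    case 2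
    then show ?thesis using single[of "k div 2 - 1"] by auto
  next
    case 3
    then have "k \<noteq> 2" by auto
    with 3 have "(k - 3) div 2 < w" "k = 2 * ((k - 3) div 2) + 3"
      by presburger+
    then show ?thesis by (rule low)
  next
    case 4
    then show ?thesis using high[of "k - w - 3"] assms by auto
  qed
qed

lemma f_2: "f 2 = a" and f_3: "f 3 = 2 * a" and f_4: "f 4 = a + s"
  using f_single[of 0] f_pair_low[of 0] f_single[of 1] w_pos
  by (simp_all add: eval_nat_numeral)

lemma f_less_Suc:
  assumes "1 \<le> k" "k < 3 * w + 3"
  shows "f k < f (Suc k)"
proof -
  from assms(1) have "k \<le> 3 * w + 3"
    using assms(2) by simp
  with assms(1) show ?thesis
  proof (cases k rule: index_cases)
    case one
    then show ?thesis
      using f_1 f_2 a_gt_1 by (simp add: numeral_2_eq_2)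
  next
    case (single j)
    then show ?thesis
      using f_single[of j] f_pair_low[of j] a_gt_1 by (simp add: numeral_3_eq_3)
  next
    case (low j)
    then show ?thesis
      using f_single[of "Suc j"] f_pair_low[of j] s_gt_a
      by (simp add: numeral_3_eq_3 algebra_simps)
  next
    case (high j)
    then show ?thesis
      using f_pair_high[of "Suc j"] f_pair_high[of j] assms s_gt_a a_gt_1
      by (simp add: algebra_simps)
  qed
qed

lemma f_less:
  assumes "1 \<le> i" "i < j" "j \<le> 3 * w + 3"
  shows "f i < f j"
  using assms(2,3)
proof (induction j)
  case (Suc j)
  then show ?case
    using f_less_Suc[of j] assms(1) by (cases "i = j") force+
qed simp

lemma f_le: "1 \<le> i \<Longrightarrow> i \<le> j \<Longrightarrow> j \<le> 3 * w + 3 \<Longrightarrow> f i \<le> f j"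
  using f_less[of i j] by (cases "i = j") auto

lemma set_prefix: "set (prefix_system n) = f ` {1..n}"
  by auto

lemma one_in_prefix: "1 \<le> n \<Longrightarrow> 1 \<in> set (prefix_system n)"
  unfolding set_prefix using f_1 by (intro image_eqI[of _ _ 1]) auto

lemma coin_system_prefix:
  assumes "1 \<le> n" "n \<le> 3 * w + 3"
  shows "coin_system (prefix_system n)"
  using assms f_1 f_less
  by (auto simp: coin_system_def sorted_wrt_iff_nth_less hd_map simp del: upt_Suc)

lemma grd_prefix_step:
  assumes "1 \<le> k" "k \<le> n" "n \<le> 3 * w + 3" "f k \<le> v" "k = n \<or> v < f (Suc k)"
  shows "grd (prefix_system n) v = Suc (grd (prefix_system n) (v - f k))"
proof (rule grd_step)
  show "f k \<in> set (prefix_system n)"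
    using assms unfolding set_prefix by auto
  show "0 < f k"
    using f_le[of 1 k] f_1 assms by simp
  fix d assume "d \<in> set (prefix_system n)" "d \<le> v"
  then obtain i where i: "1 \<le> i" "i \<le> n" "d = f i"
    by auto
  have "i \<le> k"
  proof (rule ccontr)
    assume "\<not> i \<le> k"
    then show False
      using f_le[of "Suc k" i] assms i \<open>d \<le> v\<close> by auto
  qed
  then show "d \<le> f k"
    using f_le[of i k] i assms by simp
qed (use assms in auto)

lemma set_full_prefix: "set (prefix_system (3 * w + 3)) = coins"
proof -
  have "f k \<in> coins" if "1 \<le> k" "k \<le> 3 * w + 3" for k
    using that
  proof (cases k rule: index_cases)
    case one
    then show ?thesis by (simp add: coins_def f_1[simplified])
  next
    case (single j)
    then show ?thesis using f_single[of j] by (auto simp: coins_def)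
  next
    case (low j)
    then show ?thesis using f_pair_low[of j] by (auto simp: coins_def)
  next
    case (high j)
    then show ?thesis using f_pair_high[of j] by (auto simp: coins_def)
  qed
  moreover have "c \<in> f ` {1..3 * w + 3}" if "c \<in> coins" for c
  proof -
    from that consider "c = 1" | j where "j \<le> w" "c = a + int j * s"
      | j where "j < w" "c = 2 * a + int j * s" | j where "w \<le> j" "j \<le> 2 * w" "c = 2 * a + int j * s"
      unfolding coins_def using not_le by blast
    then show ?thesis
    proof cases
      case 1
      then show ?thesis using f_1 by (intro image_eqI[of _ _ 1]) auto
    next
      case (2 j)
      then show ?thesis using f_single[of j] by (intro image_eqI[of _ _ "2 * j + 2"]) auto
    next
      case (3 j)
      then show ?thesis using f_pair_low[of j] by (intro image_eqI[of _ _ "2 * j + 3"]) auto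
    next
      case (4 j)
      then show ?thesis using f_pair_high[of j] by (intro image_eqI[of _ _ "w + j + 3"]) auto
    qed
  qed
  ultimately show ?thesis
    unfolding set_prefix by (auto simp del: One_nat_def)
qed

section \<open>Prefixes that are not orderly\<close>

text \<open>Since \<open>a < s < f 4\<close>, only \<open>s = 2 * a\<close> is in question; but
  \<open>s\<close> is \<open>2 * a - 1\<close> for \<open>m = 2\<close> and at least
  \<open>4 * a - 2\<close> otherwise.\<close>

lemma s_not_coin: "s \<noteq> f k" if "1 \<le> k" "k \<le> 3 * w + 3"
proof
  assume s: "s = f k"
  then have "\<not> 4 \<le> k"
    using f_le[of 4 k] f_4 a_gt_1 that by auto
  then have "k = 1 \<or> k = 2 \<or> k = 3"
    using that by linarith
  then have "s = 2 * a"
    using s s_gt_a a_gt_1 f_1 f_2 f_3 by auto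
  moreover have "s = 2 * a - 1 \<or> 2 * (2 * a - 1) \<le> s"
  proof (cases "m = 2")
    case False
    then have "2 * (2 * a - 1) \<le> (m - 1) * (2 * a - 1)"
      using m_gt_1 a_gt_1 by (intro mult_right_mono) auto
    then show ?thesis by (simp add: s_def)
  qed (simp add: s_def)
  ultimately show False
    using a_gt_1 by auto
qed

text \<open>The witness \<open>f n + s\<close> is a sum of two units, but the greedy remainder \<open>s\<close> is not a coin.\<close>

lemma not_orderly_pair:
  assumes n: "4 \<le> n" "n \<le> 3 * w + 3" "f n = 2 * a + int j * s"
    and pq: "p \<le> w" "q \<le> w" "p + q = Suc j" "2 * p + 2 \<le> n" "2 * q + 2 \<le> n"
  shows "\<not> orderly (prefix_system n)"
proof -
  let ?C = "prefix_system n"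
  let ?N = "{#f (2 * p + 2), f (2 * q + 2)#}"
  have "sum_mset ?N = 2 * a + int (p + q) * s"
    using f_single pq(1,2) by (simp add: distrib_right)
  then have sum: "sum_mset ?N = f n + s"
    using n pq(3) by (simp add: algebra_simps)
  have "set_mset ?N \<subseteq> set ?C"
    unfolding set_prefix using pq by auto
  from opt_le[OF this] have "opt ?C (f n + s) \<le> 2"
    using sum by simp
  moreover have "grd ?C (f n + s) = Suc (grd ?C s)"
    using grd_prefix_step[of n n "f n + s"] n s_gt_a a_gt_1 by simp
  moreover have "2 \<le> grd ?C s"
  proof (rule grd_ge_2)
    show "s \<notin> set ?C"
    proof
      assume "s \<in> set ?C"
      then obtain k where "1 \<le> k" "k \<le> n" "s = f k"
        unfolding set_prefix by auto
      then show False
        using s_not_coin[of k] n by simp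
    qed
  qed (use one_in_prefix[of n] n s_gt_a a_gt_1 in simp_all)
  moreover have "0 < f n + s"
    using f_le[of 1 n] f_1 n s_gt_a a_gt_1 by simp
  ultimately show ?thesis
    unfolding orderly_def by force
qed

text \<open>The witness \<open>f n + a + (m - 1)\<close> is the sum of \<open>f (n - 1) = 2 a + (j - 1) s\<close> and \<open>m - 1\<close>
  coins \<open>2 a\<close>, whereas the greedy algorithm takes \<open>f n\<close>, \<open>a\<close> and \<open>m - 1\<close> ones.\<close>

lemma not_orderly_single:
  assumes j: "1 \<le> j" "j \<le> w"
  shows "\<not> orderly (prefix_system (2 * j + 2))"
proof -
  define n where "n = 2 * j + 2"
  let ?C = "prefix_system n"
  define k where "k = nat (m - 1)"
  have k: "m = int k + 1" "int k < a"
    using m_gt_1 m_le_a by (auto simp: k_def)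
  obtain i where i: "j = Suc i"
    using j by (cases j) auto
  have fn: "f n = a + int j * s" "f (n - 1) = 2 * a + int i * s"
    using f_single[of j] f_pair_low[of i] j i by (auto simp: n_def eval_nat_numeral)
  have n: "4 \<le> n" "n \<le> 3 * w + 3"
    using j by (auto simp: n_def)
  let ?N = "add_mset (f (n - 1)) (replicate_mset k (f 3))"
  have "s = int k * (2 * a - 1)"
    using s_def k by simp
  then have sum: "sum_mset ?N = f n + a + int k"
    unfolding fn f_3 using i by (simp add: algebra_simps)
  have "set_mset ?N \<subseteq> set ?C"
    using n by (auto split: if_splits)
  from opt_le[OF this] have "opt ?C (f n + a + int k) \<le> Suc k"
    using sum by simp
  moreover have "grd ?C (f n + a + int k) = Suc (grd ?C (a + int k))"
    using grd_prefix_step[of n n "f n + a + int k"] n a_gt_1 by (simp add: algebra_simps)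
  \<comment> \<open>\<open>m \<le> a\<close> enters here: \<open>k < a\<close> puts the remainder
    below \<open>f 3 = 2 * a\<close>.\<close>
  moreover have "grd ?C (a + int k) = Suc (grd ?C (int k))"
    using grd_prefix_step[of 2 n "a + int k"] n f_2 f_3 k by (simp add: eval_nat_numeral)
  moreover have "grd ?C (int k) = k"
  proof (rule grd_ones)
    fix d assume "d \<in> set ?C" "d \<le> int k"
    then obtain i where i: "1 \<le> i" "i \<le> n" "d = f i"
      by auto
    then have "\<not> 2 \<le> i"
      using f_le[of 2 i] f_2 k n \<open>d \<le> int k\<close> by auto
    then have "i = 1"
      using i by simp
    then show "d \<le> 1"
      using i f_1 by simp
  qed (use one_in_prefix n in simp)
  moreover have "0 < f n + a + int k"
    using f_le[of 1 n] f_1 n a_gt_1 by simp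
  ultimately show ?thesis
    unfolding orderly_def n_def[symmetric] by force
qed

lemma not_orderly_prefix:
  assumes "4 \<le> n" "n < 3 * w + 3"
  shows "\<not> orderly (prefix_system n)"
proof -
  have "1 \<le> n" "n \<le> 3 * w + 3"
    using assms by auto
  then show ?thesis
  proof (cases n rule: index_cases)
    case one
    then show ?thesis using assms by simp
  next
    case (single j)
    then show ?thesis using not_orderly_single[of j] assms by auto
  next
    case (low j)
    then show ?thesis
      \<comment> \<open>Index \<open>j + 1\<close> is split as \<open>1 + j\<close>, with both units
        already in the prefix.\<close>
      using not_orderly_pair[of n j 1 j] f_pair_low[of j] assms w_pos by auto
  next
    case (high j)
    then show ?thesis
      \<comment> \<open>All units are available, and \<open>n < 3 * w + 3\<close> gives
        \<open>j < 2 * w\<close>, so both parts of \<open>j + 1\<close> are at most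
        \<open>w\<close>.\<close>
      using not_orderly_pair[of n j w "Suc j - w"] f_pair_high[of j] assms w_pos by auto
  qed
qed

lemma orderly_prefix_3: "orderly (prefix_system 3)"
proof -
  interpret short: units a m s 0
    by unfold_locales (use m_gt_1 m_le_a s_def in auto)
  have "set (prefix_system 3) = short.coins"
    using f_1 f_2 f_3 by (auto simp: short.coins_def upt_rec eval_nat_numeral)
  then show ?thesis
    by (rule short.orderly_units)
qed

lemma orderly_prefix_iff:
  assumes "1 \<le> n" "n \<le> 3 * w + 3"
  shows "orderly (prefix_system n) \<longleftrightarrow> n \<le> 3 \<or> n = 3 * w + 3"
proof -
  have "orderly (prefix_system 1)" "orderly (prefix_system 2)"
    using orderly_single orderly_pair[OF a_gt_1] f_1 f_2
    by (auto simp: upt_rec numeral_2_eq_2)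
  moreover have "n = 1 \<or> n = 2 \<or> n = 3 \<or> 4 \<le> n"
    using assms by linarith
  ultimately show ?thesis
    using orderly_prefix_3 orderly_units[OF set_full_prefix] not_orderly_prefix[of n] assms
    by (auto simp del: upt_Suc)
qed

end

section \<open>From the recurrence to the closed form and the pattern\<close>

theorem theorem4p7:
  fixes r :: nat and m a :: int and f :: "nat \<Rightarrow> int"
  assumes "2 \<le> r"
    and "1 < m" and "m \<le> a"
    and "f 1 = 1"
    and "f 2 = a"
    and "\<And>k. odd k \<Longrightarrow> 3 \<le> k \<Longrightarrow> k \<le> 2 * r + 1 \<Longrightarrow> f k = f (k - 1) + a"
    and "\<And>k. even k \<Longrightarrow> 3 < k \<Longrightarrow> k < 2 * r + 1 \<Longrightarrow>
           f k = f (k - 1) + (m - 1) * (2 * a - 1) - a"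
    and "\<And>k. 2 * r + 1 < k \<Longrightarrow> k \<le> 3 * r \<Longrightarrow> f k = f (k - 1) + (m - 1) * (2 * a - 1)"
  shows "coin_system (map f [1..<3 * r + 1]) \<and>
         pattern (map f [1..<3 * r + 1]) = ''+++'' @ replicate (3 * r - 4) (CHR ''-'') @ ''+''"
proof -
  define s where "s = (m - 1) * (2 * a - 1)"
  define w where "w = r - 1"
  have r: "r = w + 1" "1 \<le> w" and three_r: "3 * r = 3 * w + 3"
    using assms(1) by (auto simp: w_def)
  have single: "f (2 * j + 2) = a + int j * s" if "j \<le> w" for j
    using that
  proof (induction j)
    case 0
    then show ?case using assms(5) by (simp add: numeral_2_eq_2)
  next
    case (Suc j)
    have pred: "2 * Suc j + 2 - 1 = 2 * j + 3" "2 * j + 3 - 1 = 2 * j + 2"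
      by simp_all
    \<comment> \<open>The increments \<open>a\<close> and \<open>s - a\<close> add up to
      \<open>s\<close> between consecutive units.\<close>
    have "f (2 * Suc j + 2) = f (2 * j + 3) + s - a" "f (2 * j + 3) = f (2 * j + 2) + a"
      using assms(7)[of "2 * Suc j + 2"] assms(6)[of "2 * j + 3"] r Suc.prems
      unfolding pred s_def by auto
    then show ?case
      using Suc by (simp add: algebra_simps)
  qed
  have low: "f (2 * j + 3) = 2 * a + int j * s" if "j \<le> w" for j
  proof -
    have "2 * j + 3 - 1 = 2 * j + 2"
      by simp
    then show ?thesis
      using assms(6)[of "2 * j + 3"] single[OF that] r that by simp
  qed
  have high': "f (2 * w + i + 3) = 2 * a + int (w + i) * s" if "i \<le> w" for i
    using that
  proof (induction i)
    \<comment> \<open>The pair at position \<open>2 * w + 3 = 2 * r + 1\<close> ends the alternation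
      and starts the run of pairs.\<close>
    case 0
    then show ?case using low[of w] by simp
  next
    case (Suc i)
    have pred: "2 * w + Suc i + 3 - 1 = 2 * w + i + 3"
      by simp
    have "f (2 * w + Suc i + 3) = f (2 * w + i + 3) + s"
      using assms(8)[of "2 * w + Suc i + 3"] r(1) Suc.prems unfolding pred s_def by linarith
    then show ?case
      using Suc by (simp add: algebra_simps)
  qed
  have high: "f (w + j + 3) = 2 * a + int j * s" if "w \<le> j" "j \<le> 2 * w" for j
  proof -
    have "2 * w + (j - w) = w + j" "w + (j - w) = j" "j - w \<le> w"
      using that by simp_all
    then show ?thesis
      using high'[of "j - w"] by (simp only:)
  qed
  interpret coin_chain a m s w f
    by unfold_locales (use assms s_def r single low high in auto)
  have "orderly (take i (prefix_system (3 * r))) \<longleftrightarrow> i \<le> 3 \<or> i = 3 * r"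
    if "1 \<le> i" "i \<le> 3 * r" for i
    using orderly_prefix_iff[of i] that unfolding three_r by (simp add: take_map del: upt_Suc)
  then have "pattern (prefix_system (3 * r)) =
      map (\<lambda>i. if i \<le> 3 \<or> i = 3 * r then CHR ''+'' else CHR ''-'') [1..<3 * r + 1]"
    unfolding pattern_def by (intro map_cong) (auto simp del: upt_Suc)
  moreover have "[1..<3 * r + 1] = [1, 2, 3] @ [4..<3 * r] @ [3 * r]"
    using assms(1) upt_conv_Cons[of 1 "3 * r"] upt_conv_Cons[of 2 "3 * r"]
      upt_conv_Cons[of 3 "3 * r"] by (simp add: numeral_2_eq_2[symmetric])
  moreover have "map (\<lambda>i. if i \<le> 3 \<or> i = 3 * r then CHR ''+'' else CHR ''-'') [4..<3 * r] =
      replicate (3 * r - 4) (CHR ''-'')"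
    by (intro replicate_eqI) auto
  ultimately have "pattern (prefix_system (3 * r)) = ''+++'' @ replicate (3 * r - 4) (CHR ''-'') @ ''+''"
    by simp
  then show ?thesis
    using coin_system_prefix[of "3 * r"] three_r by (simp del: upt_Suc)
qed

end
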